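(* Let $\{a_n\}_{n\ge 1}$ be a sequence of positive real numbers such that the following conditions hold. (a) The sequence $a_n$ monotonically increases to infinity: $a_{n+1}\ge a_n$ for all $n\ge 1$, and $a_n\to\infty$ as $n\to\infty$. (b) The infinite product $f(z)=\prod_{n\ge 1}\left(1+\frac{z^2}{a_n^2}\right)$ converges uniformly on compact subsets of $\mathbb{C}$. Then the function $x\mapsto \frac{1}{f(x)}=\prod_{n\ge 1}\frac{1}{1+x^2/a_n^2}$ on $\mathbb{R}$ belongs to the Schwartz space $\mathcal{S}(\mathbb{R})$.
   Context: $\mathcal{S}(\mathbb{R})$ denotes the Schwartz space of rapidly decreasing smooth functions on the real line all of whose derivatives are also rapidly decreasing. *)

theory Defs
  imports "HOL-Complex_Analysis.Complex_Analysis"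
begin

definition higher_vector_derivative :: "nat \<Rightarrow> (real \<Rightarrow> 'a::real_normed_vector) \<Rightarrow> real \<Rightarrow> 'a"
  where "higher_vector_derivative k = ((\<lambda>g x. vector_derivative g (at x)) ^^ k)"

(* Since vector_derivative is a total function, smoothness is imposed separately:
   every iterated derivative must be differentiable at every point. *)
definition schwartz_space :: "(real \<Rightarrow> complex) set"
  where "schwartz_space =
    {g. (\<forall>k x. higher_vector_derivative k g differentiable at x) \<and>
        (\<forall>m k. bounded (range (\<lambda>x. x ^ m *\<^sub>R higher_vector_derivative k g x)))}"

end

theory Submission
  imports Defs
begin

text \<open>For \<open>\<bar>Im z\<bar> \<le> a\<^sub>1 / 2\<close> each factor satisfies
  \<open>\<bar>1 + z\<^sup>2/a\<^sub>n\<^sup>2\<bar> \<ge> (1 + (Re z)\<^sup>2/a\<^sub>n\<^sup>2) / (1 + a\<^sub>1\<^sup>2/a\<^sub>n\<^sup>2)\<close>, so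
  \<open>\<bar>f z\<bar> \<ge> f (Re z) / f a\<^sub>1\<close>. Hence \<open>1/f\<close> is holomorphic in a strip around the real
  axis and decays there faster than any power of \<open>Re z\<close>; Cauchy's estimates on discs of fixed
  radius carry this decay over to all derivatives on the real line.\<close>

lemma has_vector_derivative_of_real_compose:
  assumes "(G has_field_derivative G') (at (complex_of_real x))"
  shows "((\<lambda>x. G (complex_of_real x)) has_vector_derivative G') (at x)"
proof -
  have "((\<lambda>x. complex_of_real x) has_vector_derivative 1) (at x)"
    by (auto intro!: derivative_eq_intros)
  from field_vector_diff_chain_at[OF this assms] show ?thesis
    by (simp add: o_def)
qed

text \<open>This turns the iterated real derivatives in the definition of
  \<open>schwartz_space\<close> into complex ones, to which Cauchy's inequality applies.\<close>

lemma higher_vector_derivative_of_real: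
  assumes "G holomorphic_on S" "open S" "\<real> \<subseteq> S"
  shows "higher_vector_derivative k (\<lambda>x. G (complex_of_real x)) =
    (\<lambda>x. (deriv ^^ k) G (complex_of_real x))"
proof (induction k)
  case 0
  then show ?case by (simp add: higher_vector_derivative_def)
next
  case (Suc k)
  have "vector_derivative (\<lambda>x. (deriv ^^ k) G (complex_of_real x)) (at x)
      = (deriv ^^ Suc k) G (complex_of_real x)" for x
  proof -
    have "(deriv ^^ k) G holomorphic_on S"
      using assms holomorphic_higher_deriv by blast
    then have "((deriv ^^ k) G has_field_derivative deriv ((deriv ^^ k) G) (complex_of_real x))
        (at (complex_of_real x))"
      using assms by (meson Reals_of_real holomorphic_derivI subsetD)
    from vector_derivative_at[OF has_vector_derivative_of_real_compose[OF this]]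
    show ?thesis by simp
  qed
  then show ?case
    using Suc by (simp add: higher_vector_derivative_def)
qed

text \<open>Decay of \<open>G\<close> alone suffices: discs of one fixed radius about all real
  points fit into the strip, so Cauchy's inequality bounds the \<open>k\<close>-th derivative at the
  cost of a factor \<open>fact k / r ^ k\<close> independent of the point.\<close>

lemma schwartz_space_of_strip_decay:
  fixes G :: "complex \<Rightarrow> complex"
  assumes hol: "G holomorphic_on {z. \<bar>Im z\<bar> < d}" and d: "d > 0"
    and decay: "\<And>m. \<exists>B. \<forall>z. \<bar>Im z\<bar> < d \<longrightarrow> \<bar>Re z\<bar> ^ m * norm (G z) \<le> B"
  shows "(\<lambda>x. G (complex_of_real x)) \<in> schwartz_space"
proof -
  define S where "S = {z. \<bar>Im z\<bar> < d}"
  have S: "open S" "\<real> \<subseteq> S"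
    unfolding S_def using d
    by (auto intro!: open_Collect_less continuous_intros elim!: Reals_cases)
  have hol': "G holomorphic_on S"
    using hol by (simp add: S_def)
  have hvd: "higher_vector_derivative k (\<lambda>x. G (complex_of_real x)) =
      (\<lambda>x. (deriv ^^ k) G (complex_of_real x))" for k
    by (rule higher_vector_derivative_of_real[OF hol' S])
  have "(\<lambda>x. (deriv ^^ k) G (complex_of_real x)) differentiable at x" for k x
  proof -
    have "(deriv ^^ k) G holomorphic_on S"
      using hol' S holomorphic_higher_deriv by blast
    then have "((deriv ^^ k) G has_field_derivative deriv ((deriv ^^ k) G) (complex_of_real x))
        (at (complex_of_real x))"
      using S by (meson Reals_of_real holomorphic_derivI subsetD)
    then show ?thesis
      using has_vector_derivative_of_real_compose differentiableI_vector by blast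
  qed
  moreover have "bounded (range (\<lambda>x. x ^ m *\<^sub>R (deriv ^^ k) G (complex_of_real x)))" for m k
  proof -
    define r where "r = d / 2"
    have r: "r > 0" "r < d" using d by (auto simp: r_def)
    obtain B where B: "\<And>z. z \<in> S \<Longrightarrow> \<bar>Re z\<bar> ^ m * norm (G z) \<le> B"
      using decay[of m] by (auto simp: S_def)
    \<comment> \<open>The exponent 0 gives plain boundedness, needed for the term
      \<open>r ^ m\<close> that appears when the weight moves from \<open>Re z\<close> to the centre
      \<open>x\<close>.\<close>
    obtain B0 where B0: "\<And>z. z \<in> S \<Longrightarrow> norm (G z) \<le> B0"
      using decay[of 0] by (auto simp: S_def)
    \<comment> \<open>On the circle, \<open>\<bar>x\<bar>\<close> is at most twice the maximum of
      \<open>\<bar>Re z\<bar>\<close> and \<open>r\<close>, and the \<open>m\<close>-th power of a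
      maximum is at most the sum of the \<open>m\<close>-th powers.\<close>
    define C where "C = 2 ^ m * (B + r ^ m * B0)"
    have C: "\<bar>x\<bar> ^ m * norm (G z) \<le> C"
      if z: "norm (complex_of_real x - z) = r" and "z \<in> S" for x z
    proof -
      have "\<bar>x\<bar> \<le> \<bar>Re z\<bar> + r"
        using abs_Re_le_cmod[of "complex_of_real x - z"] z by simp
      also have "\<dots> \<le> 2 * max \<bar>Re z\<bar> r" by simp
      finally have "\<bar>x\<bar> ^ m \<le> (2 * max \<bar>Re z\<bar> r) ^ m"
        by (intro power_mono) auto
      also have "\<dots> \<le> 2 ^ m * (\<bar>Re z\<bar> ^ m + r ^ m)"
        using r by (simp add: power_mult_distrib max_def)
      finally have "\<bar>x\<bar> ^ m * norm (G z) \<le> 2 ^ m * (\<bar>Re z\<bar> ^ m + r ^ m) * norm (G z)"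
        by (intro mult_right_mono) auto
      also have "\<dots> = 2 ^ m * (\<bar>Re z\<bar> ^ m * norm (G z) + r ^ m * norm (G z))"
        by (simp add: algebra_simps)
      also have "\<dots> \<le> C"
        unfolding C_def using B[OF \<open>z \<in> S\<close>] B0[OF \<open>z \<in> S\<close>] r
        by (intro mult_left_mono add_mono) auto
      finally show ?thesis .
    qed
    have "norm (x ^ m *\<^sub>R (deriv ^^ k) G (complex_of_real x)) \<le> fact k * C / r ^ k" for x
    proof -
      have sub: "cball (complex_of_real x) r \<subseteq> S"
      proof
        fix z assume "z \<in> cball (complex_of_real x) r"
        then have "\<bar>Im (complex_of_real x - z)\<bar> \<le> r"
          using abs_Im_le_cmod[of "complex_of_real x - z"] by (simp add: dist_norm)
        then show "z \<in> S" using r by (simp add: S_def)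
      qed
      \<comment> \<open>The weight is frozen at the centre \<open>x\<close>: it is a constant in
        \<open>z\<close>, so it passes through \<open>deriv\<close> unchanged and the estimate for
        \<open>H\<close> is already the weighted one.\<close>
      define H where "H = (\<lambda>z. complex_of_real x ^ m * G z)"
      have H: "H holomorphic_on S"
        unfolding H_def using hol' by (intro holomorphic_intros)
      have "norm ((deriv ^^ k) H (complex_of_real x)) \<le> fact k * C / r ^ k"
      proof (rule Cauchy_inequality)
        show "H holomorphic_on ball (complex_of_real x) r"
          using H sub ball_subset_cball holomorphic_on_subset by blast
        show "continuous_on (cball (complex_of_real x) r) H"
          using H sub continuous_on_subset holomorphic_on_imp_continuous_on by blast
        show "norm (H z) \<le> C" if "norm (complex_of_real x - z) = r" for z
          using C[OF that] that sub
          by (auto simp: H_def norm_mult norm_power dist_norm subset_iff)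
      qed (use r in auto)
      also have "(deriv ^^ k) H (complex_of_real x) =
          complex_of_real x ^ m * (deriv ^^ k) G (complex_of_real x)"
        unfolding H_def using S
        by (intro higher_deriv_cmult[OF hol']) auto
      finally show ?thesis
        by (simp add: norm_mult norm_power power_abs)
    qed
    then show ?thesis
      by (auto simp: bounded_iff)
  qed
  ultimately show ?thesis
    by (simp add: schwartz_space_def hvd)
qed

text \<open>The real part of the factor is \<open>1 + u - t\<close>, and the loss \<open>t\<close>
  is at most \<open>w / 4\<close> with \<open>w \<le> 1\<close>, so multiplying by
  \<open>1 + w\<close> makes up for it. The correction \<open>1 + w\<close> is the factor of
  \<open>f\<close> at the point \<open>s\<close>; hence the corrections over all factors multiply up
  to a finite constant.\<close>

lemma norm_one_plus_square_ratio_ge: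
  fixes z :: complex and c s :: real
  assumes "0 < s" "s \<le> c" "\<bar>Im z\<bar> \<le> s / 2"
  shows "(1 + (Re z)\<^sup>2 / c\<^sup>2) \<le> norm (1 + z\<^sup>2 / (complex_of_real c)\<^sup>2) * (1 + s\<^sup>2 / c\<^sup>2)"
proof -
  define t where "t = (Im z)\<^sup>2 / c\<^sup>2"
  define u where "u = (Re z)\<^sup>2 / c\<^sup>2"
  define w where "w = s\<^sup>2 / c\<^sup>2"
  have c: "c > 0" using assms by linarith
  have "\<bar>Im z\<bar>\<^sup>2 \<le> (s / 2)\<^sup>2"
    using assms by (intro power_mono) auto
  then have tw: "4 * t \<le> w"
    using c by (simp add: t_def w_def field_simps)
  have "s\<^sup>2 \<le> c\<^sup>2"
    using assms by (intro power_mono) auto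
  then have w1: "w \<le> 1"
    using c by (simp add: w_def)
  have nn: "t \<ge> 0" "u \<ge> 0" "w \<ge> 0"
    by (auto simp: t_def u_def w_def)
  have "t * w \<le> t * 1"
    using nn w1 by (intro mult_left_mono) auto
  \<comment> \<open>Expanded, the right side is \<open>1 + w - t - t * w\<close>, which is at least
    \<open>1 + w - 2 * t\<close>.\<close>
  then have "1 \<le> (1 - t) * (1 + w)"
    using tw nn by (simp add: algebra_simps)
  moreover have "u * 1 \<le> u * (1 + w)"
    using nn by (intro mult_left_mono) auto
  ultimately have "1 + u \<le> (1 + u - t) * (1 + w)"
    by (simp add: algebra_simps)
  also have "1 + u - t = Re (1 + z\<^sup>2 / (complex_of_real c)\<^sup>2)"
    using Re_divide_of_real[of "z\<^sup>2" "c\<^sup>2"]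
    by (simp add: Re_power2 t_def u_def diff_divide_distrib)
  also have "Re (1 + z\<^sup>2 / (complex_of_real c)\<^sup>2) \<le> norm (1 + z\<^sup>2 / (complex_of_real c)\<^sup>2)"
    by (rule complex_Re_le_cmod)
  finally show ?thesis
    using nn by (simp add: u_def w_def mult_right_mono)
qed

theorem theorem2:
  fixes a :: "nat \<Rightarrow> real" and f :: "complex \<Rightarrow> complex"
  assumes pos: "\<And>n. n \<ge> 1 \<Longrightarrow> a n > 0"
    and mono: "\<And>n. n \<ge> 1 \<Longrightarrow> a (n + 1) \<ge> a n"
    and lim: "filterlim a at_top sequentially"
    and f: "\<And>z. f z = (\<Prod>n. 1 + z\<^sup>2 / (complex_of_real (a (Suc n)))\<^sup>2)"
    and conv: "\<And>K. compact K \<Longrightarrow>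
      uniform_limit K (\<lambda>N z. \<Prod>n=1..N. 1 + z\<^sup>2 / (complex_of_real (a n))\<^sup>2) f sequentially"
  shows "(\<lambda>x::real. 1 / f (complex_of_real x)) \<in> schwartz_space \<and>
    (\<forall>x::real. (\<lambda>n. 1 / (1 + (complex_of_real x)\<^sup>2 / (complex_of_real (a (Suc n)))\<^sup>2))
       has_prod (1 / f (complex_of_real x)))"
proof -
  define P where "P = (\<lambda>N z. \<Prod>n=1..N. 1 + z\<^sup>2 / (complex_of_real (a n))\<^sup>2)"
  define s where "s = a 1"
  have s: "s > 0" using pos by (simp add: s_def)
  have s_le: "s \<le> a n" if "n \<ge> 1" for n
    using that by (induction n rule: dec_induct) (use mono in \<open>auto simp: s_def intro: order_trans\<close>)
  have P_lim: "(\<lambda>N. P N z) \<longlonglongrightarrow> f z" for z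
    using tendsto_uniform_limitI[OF conv[of "{z}"], of z] by (simp add: P_def)
  have P_real: "norm (P N (complex_of_real x)) = (\<Prod>n=1..N. 1 + x\<^sup>2 / (a n)\<^sup>2)" for N x
  proof -
    have "P N (complex_of_real x) = complex_of_real (\<Prod>n=1..N. 1 + x\<^sup>2 / (a n)\<^sup>2)"
      by (simp add: P_def)
    also have "norm \<dots> = (\<Prod>n=1..N. 1 + x\<^sup>2 / (a n)\<^sup>2)"
      by (subst norm_of_real, intro abs_of_nonneg prod_nonneg) auto
    finally show ?thesis .
  qed
  have f_hol: "f holomorphic_on UNIV"
  proof (rule holomorphic_uniform_sequence)
    show "P n holomorphic_on UNIV" for n
      unfolding P_def divide_inverse by (intro holomorphic_intros)
    show "\<exists>d>0. cball x d \<subseteq> UNIV \<and> uniform_limit (cball x d) P f sequentially" for x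
      using conv[of "cball x 1"] by (intro exI[of _ 1]) (auto simp: P_def)
  qed auto
  have strip: "norm (f (complex_of_real (Re z))) \<le> norm (f z) * norm (f (complex_of_real s))"
    if "\<bar>Im z\<bar> \<le> s / 2" for z
  proof (rule LIMSEQ_le)
    show "(\<lambda>N. norm (P N (complex_of_real (Re z)))) \<longlonglongrightarrow> norm (f (complex_of_real (Re z)))"
      by (intro tendsto_norm P_lim)
    show "(\<lambda>N. norm (P N z) * norm (P N (complex_of_real s)))
        \<longlonglongrightarrow> norm (f z) * norm (f (complex_of_real s))"
      by (intro tendsto_intros P_lim)
    have "norm (P N (complex_of_real (Re z))) \<le> norm (P N z) * norm (P N (complex_of_real s))" for N
      \<comment> \<open>\<open>P_real\<close> first turns the norms at \<open>Re z\<close> and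
        \<open>s\<close> into real products; the norm at \<open>z\<close> is then pulled inside its
        product and the right side merged into one product, leaving a comparison factor by
        factor.\<close>
      unfolding P_real unfolding P_def prod_norm[symmetric] prod.distrib[symmetric]
      by (intro prod_mono conjI norm_one_plus_square_ratio_ge s s_le that) auto
    then show "\<exists>N. \<forall>n\<ge>N. norm (P n (complex_of_real (Re z)))
        \<le> norm (P n z) * norm (P n (complex_of_real s))"
      by blast
  qed
  \<comment> \<open>At real points every factor is at least 1, so the partial products increase to
    their limit.\<close>
  have P_le_f: "norm (P N (complex_of_real x)) \<le> norm (f (complex_of_real x))" for N x
  proof (rule incseq_le)
    show "(\<lambda>N. norm (P N (complex_of_real x))) \<longlonglongrightarrow> norm (f (complex_of_real x))"
      by (intro tendsto_norm P_lim)
    have "(\<Prod>n=1..N. 1 + x\<^sup>2 / (a n)\<^sup>2) * 1 \<le> (\<Prod>n=1..N. 1 + x\<^sup>2 / (a n)\<^sup>2) * (1 + x\<^sup>2 / (a (Suc N))\<^sup>2)" for N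
      by (intro mult_left_mono prod_nonneg) auto
    then show "incseq (\<lambda>N. norm (P N (complex_of_real x)))"
      unfolding P_real by (intro incseq_SucI) simp
  qed
  have f_ge1: "1 \<le> norm (f (complex_of_real x))" for x
    \<comment> \<open>The empty partial product is 1.\<close>
    using P_le_f[of 0 x] by (simp add: P_def)
  have f_nz: "f z \<noteq> 0" if "\<bar>Im z\<bar> \<le> s / 2" for z
    using strip[OF that] f_ge1[of "Re z"] by auto

  have "(\<lambda>x. 1 / f (complex_of_real x)) \<in> schwartz_space"
  proof (rule schwartz_space_of_strip_decay)
    show "(\<lambda>z. 1 / f z) holomorphic_on {z. \<bar>Im z\<bar> < s / 2}"
      using f_nz by (intro holomorphic_intros holomorphic_on_subset[OF f_hol]) auto
    show "s / 2 > 0" using s by simp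
    fix m
    \<comment> \<open>Since \<open>(a n)\<^sup>2 * (1 + x\<^sup>2 / (a n)\<^sup>2)\<close> equals
      \<open>(a n)\<^sup>2 + x\<^sup>2\<close>, the first \<open>m\<close> factors of
      \<open>f\<close> times \<open>A\<close> already dominate the power \<open>2 * m\<close> of
      \<open>x\<close>.\<close>
    define A where "A = (\<Prod>n=1..m. (a n)\<^sup>2)"
    have A: "A > 0"
      unfolding A_def by (intro prod_pos zero_less_power pos) auto
    define F where "F = norm (f (complex_of_real s))"
    have "\<bar>Re z\<bar> ^ m * norm (1 / f z) \<le> (1 + A) * F" if z: "\<bar>Im z\<bar> < s / 2" for z
    proof -
      define x where "x = Re z"
      define y where "y = norm (f (complex_of_real x))"
      have y: "y \<ge> 1" using f_ge1 by (simp add: y_def)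
      have yF: "y \<le> norm (f z) * F"
        using strip[of z] z by (simp add: y_def F_def x_def)
      have "x\<^sup>2 ^ m = (\<Prod>n=1..m. x\<^sup>2)" by simp
      also have "\<dots> \<le> (\<Prod>n=1..m. (a n)\<^sup>2 * (1 + x\<^sup>2 / (a n)\<^sup>2))"
      proof (intro prod_mono conjI)
        fix n assume "n \<in> {1..m}"
        then have "a n \<noteq> 0" using pos[of n] by simp
        then show "x\<^sup>2 \<le> (a n)\<^sup>2 * (1 + x\<^sup>2 / (a n)\<^sup>2)"
          by (simp add: algebra_simps)
      qed auto
      also have "\<dots> = A * norm (P m (complex_of_real x))"
        unfolding P_real A_def by (rule prod.distrib)
      also have "\<dots> \<le> A * y"
        unfolding y_def using A P_le_f by (intro mult_left_mono) auto
      finally have xm: "x\<^sup>2 ^ m \<le> A * y" .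
      \<comment> \<open>The summand 1 covers small \<open>x\<close>; it is absorbed next through
        \<open>1 \<le> y\<close>.\<close>
      have "\<bar>x\<bar> ^ m \<le> 1 + x\<^sup>2 ^ m"
      proof (cases "\<bar>x\<bar> \<le> 1")
        case True
        then have "\<bar>x\<bar> ^ m \<le> 1" by (intro power_le_one) auto
        then show ?thesis by (simp add: add_increasing2)
      next
        case False
        then have "\<bar>x\<bar> ^ m \<le> \<bar>x\<bar> ^ (2 * m)" by (intro power_increasing) auto
        then show ?thesis by (simp add: power_mult)
      qed
      also have "\<dots> \<le> (1 + A) * y"
        using xm y by (simp add: algebra_simps)
      also have "\<dots> \<le> (1 + A) * (norm (f z) * F)"
        using yF A by (intro mult_left_mono) auto
      finally have "\<bar>x\<bar> ^ m \<le> (1 + A) * F * norm (f z)"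
        by (simp add: mult_ac)
      then show ?thesis
        using f_nz[of z] z by (simp add: x_def norm_divide divide_le_eq)
    qed
    then show "\<exists>B. \<forall>z. \<bar>Im z\<bar> < s / 2 \<longrightarrow> \<bar>Re z\<bar> ^ m * norm (1 / f z) \<le> B"
      by blast
  qed
  moreover have "(\<lambda>n. 1 / (1 + (complex_of_real x)\<^sup>2 / (complex_of_real (a (Suc n)))\<^sup>2))
      has_prod (1 / f (complex_of_real x))" for x
  proof -
    have nz: "f (complex_of_real x) \<noteq> 0"
      using f_ge1[of x] by auto
    \<comment> \<open>The partial products in \<open>has_prod\<close> run over
      \<open>n \<le> N\<close>, hence have \<open>N + 1\<close> factors, so \<open>P\<close> is
      taken at \<open>Suc N\<close>. The definition also demands a nonzero limit, which
      \<open>nz\<close> supplies.\<close>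
    have "(\<lambda>N. 1 / P (Suc N) (complex_of_real x)) \<longlonglongrightarrow> 1 / f (complex_of_real x)"
      using LIMSEQ_Suc[OF P_lim] nz by (intro tendsto_intros)
    also have "(\<lambda>N. 1 / P (Suc N) (complex_of_real x)) =
        (\<lambda>N. \<Prod>n\<le>N. 1 / (1 + (complex_of_real x)\<^sup>2 / (complex_of_real (a (Suc n)))\<^sup>2))"
      unfolding P_def One_nat_def
      by (subst prod.shift_bounds_cl_Suc_ivl) (simp add: prod_dividef atMost_atLeast0)
    finally show ?thesis
      using nz by (simp add: has_prod_def raw_has_prod_def)
  qed
  ultimately show ?thesis by blast
qed

end
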